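(* Let $m\ge 2$, $n\ge 1$ and $\mathcal{A}\in T_{m,n}$. Then $\mathcal{A}$ is a P tensor if and only if for each nonzero $\mathbf{x}\in\mathbb{R}^n$ there exists an $n\times n$ diagonal matrix $D_{\mathbf{x}}$ with positive diagonal entries such that $\mathbf{x}^\top D_{\mathbf{x}}(\mathcal{A}\mathbf{x}^{m-1})>0$.
   Context: $I_n=\{1,\dots,n\}$. $T_{m,n}$ is the set of real $m$th order $n$-dimensional tensors $\mathcal{A}=(a_{i_1\cdots i_m})$, $i_1,\dots,i_m\in I_n$. For $\mathbf{x}\in\mathbb{R}^n$, $\mathcal{A}\mathbf{x}^{m-1}\in\mathbb{R}^n$ has $i$th component $(\mathcal{A}\mathbf{x}^{m-1})_i=\sum_{i_2,\dots,i_m=1}^n a_{ii_2\cdots i_m}x_{i_2}\cdots x_{i_m}$. $\mathcal{A}$ is a P tensor if for every nonzero $\mathbf{x}\in\mathbb{R}^n$, $\max_{i\in I_n}x_i(\mathcal{A}\mathbf{x}^{m-1})_i>0$. *)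

theory Defs
  imports "HOL-Analysis.Analysis"
begin

(* The index set I_n is a finite type 'n with n = CARD('n); a multi-index (i_1,...,i_m) is a
   list of length m, so a tensor in T_{m,n} is a function on exactly these lists
   (fixed to be undefined on all other lists). *)
definition tensors :: "nat \<Rightarrow> ('n::finite list \<Rightarrow> real) set" where
  "tensors m = {is. length is = m} \<rightarrow>\<^sub>E UNIV"

(* The vector A x^(m-1); the list js is the multi-index (i_2,...,i_m). *)
definition tensor_apply :: "nat \<Rightarrow> ('n::finite list \<Rightarrow> real) \<Rightarrow> real ^ 'n \<Rightarrow> real ^ 'n" where
  "tensor_apply m A x =
     (\<chi> i. \<Sum>js | length js = m - 1. A (i # js) * (\<Prod>j\<leftarrow>js. x $ j))"

definition P_tensor :: "nat \<Rightarrow> ('n::finite list \<Rightarrow> real) \<Rightarrow> bool" where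
  "P_tensor m A \<longleftrightarrow> (\<forall>x. x \<noteq> 0 \<longrightarrow> (MAX i. x $ i * tensor_apply m A x $ i) > 0)"

definition diagonal_matrix :: "real ^ 'n ^ 'n \<Rightarrow> bool" where
  "diagonal_matrix D \<longleftrightarrow> (\<forall>i j. i \<noteq> j \<longrightarrow> D $ i $ j = 0)"

end

theory Submission
  imports Defs
begin

text \<open>For diagonal \<open>D\<close>, the form \<open>x \<bullet> (D *v y)\<close> is the
  combination of the products \<open>x $ i * y $ i\<close> with the diagonal entries as weights. If
  no product is positive, no positive weights make it positive; if one is, a large enough weight on
  it outweighs the rest. With \<open>y\<close> the vector \<open>tensor_apply m A x\<close>, this is
  the P condition at \<open>x\<close>.\<close>

lemma inner_diagonal_matrix_vector_mult:
  fixes D :: "real ^ 'n::finite ^ 'n"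
  assumes "diagonal_matrix D"
  shows "x \<bullet> (D *v y) = (\<Sum>i\<in>UNIV. D $ i $ i * (x $ i * y $ i))"
proof -
  have "(D *v y) $ i = D $ i $ i * y $ i" for i
  proof -
    have "(D *v y) $ i = (\<Sum>j\<in>UNIV. if j = i then D $ i $ i * y $ i else 0)"
      unfolding matrix_vector_mult_def vec_lambda_beta
      using assms by (intro sum.cong) (auto simp: diagonal_matrix_def)
    then show ?thesis by simp
  qed
  then show ?thesis
    by (simp add: inner_vec_def mult.left_commute)
qed

text \<open>Both conditions concern one \<open>x\<close> at a time and \<open>D\<close> may depend
  on \<open>x\<close>, so a fixed pair of vectors suffices.\<close>

lemma ex_pos_component_iff_ex_pos_diagonal:
  fixes x y :: "real ^ 'n::finite"
  shows "(\<exists>i. x $ i * y $ i > 0) \<longleftrightarrow>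
    (\<exists>D :: real ^ 'n ^ 'n. diagonal_matrix D \<and> (\<forall>i. D $ i $ i > 0) \<and> x \<bullet> (D *v y) > 0)"
    (is "?L \<longleftrightarrow> ?R")
proof
  define c where "c i = x $ i * y $ i" for i
  assume ?L
  then obtain k where k: "c k > 0" by (auto simp: c_def)
  \<comment> \<open>The weight at \<open>k\<close> is enlarged so that the weighted sum becomes
    \<open>\<Sum>i. c i + \<bar>c i\<bar>\<close>.\<close>
  define S where "S = (\<Sum>i\<in>UNIV. \<bar>c i\<bar>)"
  define d where "d i = 1 + (if i = k then S / c k else 0)" for i
  define D :: "real ^ 'n ^ 'n" where "D = (\<chi> i j. if i = j then d i else 0)"
  have diag: "diagonal_matrix D" by (simp add: D_def diagonal_matrix_def)
  have "S \<ge> 0" by (simp add: S_def sum_nonneg)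
  then have pos: "D $ i $ i > 0" for i
    using k by (auto simp: D_def d_def add_pos_nonneg)
  have "d i * c i = c i + (if i = k then S else 0)" for i
    using k by (auto simp: d_def field_simps)
  then have "(\<Sum>i\<in>UNIV. d i * c i) = (\<Sum>i\<in>UNIV. c i) + S"
    by (simp add: sum.distrib)
  also have "\<dots> = (\<Sum>i\<in>UNIV. c i + \<bar>c i\<bar>)"
    by (simp add: S_def sum.distrib)
  \<comment> \<open>Every summand is nonnegative, and the one at \<open>k\<close> equals
    \<open>2 * c k\<close>.\<close>
  also have "\<dots> > 0"
    using k by (intro sum_pos2[of UNIV k]) auto
  finally have "x \<bullet> (D *v y) > 0"
    unfolding inner_diagonal_matrix_vector_mult[OF diag] by (simp add: D_def c_def)
  with diag pos show ?R by blast
next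
  assume ?R
  then obtain D :: "real ^ 'n ^ 'n" where D: "diagonal_matrix D" "\<And>i. D $ i $ i > 0"
    "x \<bullet> (D *v y) > 0" by blast
  show ?L
  proof (rule ccontr)
    assume "\<not> ?L"
    then have "(\<Sum>i\<in>UNIV. D $ i $ i * (x $ i * y $ i)) \<le> 0"
      using D(2) by (intro sum_nonpos) (auto simp: not_less less_imp_le intro: mult_nonneg_nonpos[OF less_imp_le])
    with D show False by (simp add: inner_diagonal_matrix_vector_mult)
  qed
qed

theorem theorem4p2:
  fixes m :: nat and A :: "'n::finite list \<Rightarrow> real"
  assumes "m \<ge> 2" and "A \<in> tensors m"
  shows "P_tensor m A \<longleftrightarrow>
    (\<forall>x :: real ^ 'n. x \<noteq> 0 \<longrightarrow>
      (\<exists>D :: real ^ 'n ^ 'n. diagonal_matrix D \<and> (\<forall>i. D $ i $ i > 0) \<and>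
        x \<bullet> (D *v tensor_apply m A x) > 0))"
  \<comment> \<open>A maximum over the finite nonempty index type is positive iff some entry is;
    \<open>symmetric\<close> rewrites the existence of \<open>D\<close> into that form.\<close>
  by (simp add: P_tensor_def Max_gr_iff ex_pos_component_iff_ex_pos_diagonal[symmetric])

end
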